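(* For any ring $S\neq 0$ and any integer $n\ge 2$, the matrix ring $M_n(S)$ is not a $UJ^{\#}$ ring.
   Context: All rings are associative with identity. $J(R)$ is the Jacobson radical and $U(R)$ the group of units of a ring $R$. Define $J^{\#}(R)=\{z\in R : z^n\in J(R)\text{ for some } n\ge 1\}$. A ring $R$ is called a $UJ^{\#}$ ring if $U(R)=1+J^{\#}(R)$. *)

theory Defs
  imports "HOL-Algebra.Ideal" "Jordan_Normal_Form.Matrix"
begin

text \<open>
  Rings are associative and unital but not necessarily commutative, so the one-sided
  notions below are needed; \<open>ideal\<close> and \<open>maximalideal\<close> of HOL-Algebra are two-sided.
  The definitions are meaningful for any \<open>R\<close> with \<open>ring R\<close>.
\<close>

definition left_ideal :: "'a set \<Rightarrow> ('a, 'b) ring_scheme \<Rightarrow> bool" where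
  "left_ideal I R \<longleftrightarrow>
     additive_subgroup I R \<and> (\<forall>a\<in>I. \<forall>x\<in>carrier R. x \<otimes>\<^bsub>R\<^esub> a \<in> I)"

definition maximal_left_ideal :: "'a set \<Rightarrow> ('a, 'b) ring_scheme \<Rightarrow> bool" where
  "maximal_left_ideal I R \<longleftrightarrow>
     left_ideal I R \<and> I \<noteq> carrier R \<and>
     (\<forall>K. left_ideal K R \<longrightarrow> I \<subseteq> K \<longrightarrow> K = I \<or> K = carrier R)"

text \<open>
  The Jacobson radical is the intersection of all maximal left ideals, taken inside the
  carrier (so that it is the carrier when there is no maximal left ideal).
\<close>

definition jacobson_radical :: "('a, 'b) ring_scheme \<Rightarrow> 'a set" where
  "jacobson_radical R = {x \<in> carrier R. \<forall>I. maximal_left_ideal I R \<longrightarrow> x \<in> I}"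

definition J_sharp :: "('a, 'b) ring_scheme \<Rightarrow> 'a set" where
  "J_sharp R = {z \<in> carrier R. \<exists>n::nat. n \<ge> 1 \<and> z [^]\<^bsub>R\<^esub> n \<in> jacobson_radical R}"

definition UJ_sharp_ring :: "('a, 'b) ring_scheme \<Rightarrow> bool" where
  "UJ_sharp_ring R \<longleftrightarrow> Units R = {\<one>\<^bsub>R\<^esub> \<oplus>\<^bsub>R\<^esub> z | z. z \<in> J_sharp R}"

text \<open>
  The library proves that \<open>ring_mat\<close> is a ring only for commutative coefficients.
  The class \<open>ring_1\<close> is that of all nonzero unital rings: it contains \<open>0 \<noteq> 1\<close>.
\<close>

lemma ring_mat_noncomm: "ring (ring_mat TYPE('a :: ring_1) n b)"
  by (unfold_locales, insert add_inv_exists_mat, auto simp: ring_mat_def algebra_simps Units_def)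

end

(* Over any nonzero ring the companion matrix of X^2 + X + 1, padded with zeros, is a nonzero z
   with z + z^2 + z^3 = 0. Hence z^4 = z and 1 + z is a unit with inverse 1 + z^2. The left
   annihilator {x. x z = 0} is proper, so it lies in a maximal left ideal I, and 1 - z^3 is in I.
   If some z^m with m > 0 were in the Jacobson radical, then z^3 = z^(2m) z^m would be in I too,
   and so would 1. *)

theory Submission
  imports Defs
begin

context ring
begin

text \<open>Closure under negation comes for free: it is left multiplication by
  \<open>\<ominus> \<one>\<close>.\<close>

lemma left_idealI:
  assumes "I \<subseteq> carrier R" "\<zero> \<in> I"
    and add: "\<And>x y. x \<in> I \<Longrightarrow> y \<in> I \<Longrightarrow> x \<oplus> y \<in> I"
    and mult: "\<And>a x. a \<in> I \<Longrightarrow> x \<in> carrier R \<Longrightarrow> x \<otimes> a \<in> I"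
  shows "left_ideal I R"
proof -
  have "\<ominus> x \<in> I" if "x \<in> I" for x
    using mult[OF that, of "\<ominus> \<one>"] that assms(1) by (auto simp: l_minus)
  then show ?thesis
    unfolding left_ideal_def using assms
    by (auto intro!: additive_subgroup.intro subgroup.intro simp flip: a_inv_def)
qed

lemma left_idealD:
  assumes "left_ideal I R"
  shows "I \<subseteq> carrier R" "\<zero> \<in> I"
    and "\<And>x y. x \<in> I \<Longrightarrow> y \<in> I \<Longrightarrow> x \<oplus> y \<in> I"
    and "\<And>a x. a \<in> I \<Longrightarrow> x \<in> carrier R \<Longrightarrow> x \<otimes> a \<in> I"
  using assms unfolding left_ideal_def
  by (auto simp: additive_subgroup.a_closed additive_subgroup.zero_closed additive_subgroup.a_Hcarr)

lemma left_ideal_eq_carrier_iff: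
  assumes "left_ideal I R"
  shows "I = carrier R \<longleftrightarrow> \<one> \<in> I"
  using left_idealD[OF assms] by (metis one_closed r_one subsetI subset_antisym)

lemma left_ideal_Union_chain:
  assumes "C \<noteq> {}" "subset.chain A C" "\<And>I. I \<in> A \<Longrightarrow> left_ideal I R"
  shows "left_ideal (\<Union>C) R"
proof -
  have C: "left_ideal I R" if "I \<in> C" for I
    using assms that by (auto simp: subset_chain_def)
  show ?thesis
  proof (rule left_idealI)
    show "\<Union>C \<subseteq> carrier R"
      using C left_idealD(1) by blast
    show "\<zero> \<in> \<Union>C"
      using C left_idealD(2) assms(1) by blast
    show "x \<otimes> a \<in> \<Union>C" if "a \<in> \<Union>C" "x \<in> carrier R" for a x
      using C left_idealD(4) that by blast
    show "x \<oplus> y \<in> \<Union>C" if xy: "x \<in> \<Union>C" "y \<in> \<Union>C" for x y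
    proof -
      obtain I J where IJ: "I \<in> C" "J \<in> C" "x \<in> I" "y \<in> J"
        using xy by blast
      have "I \<subseteq> J \<or> J \<subseteq> I"
        using assms(2) IJ(1,2) by (auto simp: subset_chain_def)
      then show ?thesis
        using IJ C left_idealD(3) by blast
    qed
  qed
qed

lemma proper_left_ideal_subset_maximal:
  assumes "left_ideal I R" "\<one> \<notin> I"
  obtains M where "maximal_left_ideal M R" "I \<subseteq> M"
proof -
  \<comment> \<open>Properness is phrased as avoiding \<open>\<one>\<close>, a condition that passes
    to unions of chains, so Zorn's lemma applies.\<close>
  define A where "A = {K. left_ideal K R \<and> I \<subseteq> K \<and> \<one> \<notin> K}"
  have "\<exists>M\<in>A. \<forall>X\<in>A. M \<subseteq> X \<longrightarrow> X = M"
  proof (rule subset_Zorn_nonempty)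
    show "A \<noteq> {}"
      using assms by (auto simp: A_def)
    show "\<Union>C \<in> A" if C: "C \<noteq> {}" "subset.chain A C" for C
    proof -
      have "left_ideal (\<Union>C) R"
        using C by (rule left_ideal_Union_chain) (simp add: A_def)
      moreover have "I \<subseteq> \<Union>C" "\<one> \<notin> \<Union>C"
        using C unfolding subset_chain_def A_def by blast+
      ultimately show ?thesis
        by (simp add: A_def)
    qed
  qed
  then obtain M where M: "M \<in> A" "\<And>X. X \<in> A \<Longrightarrow> M \<subseteq> X \<Longrightarrow> X = M"
    by blast
  \<comment> \<open>A left ideal above \<open>M\<close> either contains \<open>\<one>\<close>, hence
    is the whole carrier, or lies in \<open>A\<close>, hence equals \<open>M\<close>.\<close>
  have "maximal_left_ideal M R"
    using M left_ideal_eq_carrier_iff unfolding maximal_left_ideal_def A_def by blast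
  with M show ?thesis
    using that by (auto simp: A_def)
qed

text \<open>With e = z^3, the relation reads e + z + z^2 = 0 in the corner ring eRe with identity e,
  where z is thus a cube root of the identity.\<close>

lemma not_UJ_sharp_ring_if_cube_root:
  assumes z: "z \<in> carrier R" "z \<noteq> \<zero>" and eq: "z \<oplus> z \<otimes> z \<oplus> z \<otimes> z \<otimes> z = \<zero>"
  shows "\<not> UJ_sharp_ring R"
proof
  assume UJ: "UJ_sharp_ring R"
  define e where "e = z \<otimes> z \<otimes> z"
  have e [simp]: "e \<in> carrier R"
    using z by (simp add: e_def)
  have ez: "e \<otimes> z = z"
  proof -
    \<comment> \<open>The relation and its right multiple by z share the terms z^2 + e; cancelling
      them leaves z^4 = z.\<close>
    have "z \<oplus> (z \<otimes> z \<oplus> e) = \<zero>"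
      using eq z by (simp add: e_def a_assoc)
    moreover have "e \<otimes> z \<oplus> (z \<otimes> z \<oplus> e) = (z \<oplus> z \<otimes> z \<oplus> z \<otimes> z \<otimes> z) \<otimes> z"
      using z by (simp add: e_def l_distr a_ac)
    ultimately have "z \<oplus> (z \<otimes> z \<oplus> e) = e \<otimes> z \<oplus> (z \<otimes> z \<oplus> e)"
      using z eq by simp
    then show ?thesis
      using z by (metis add.right_cancel add.m_closed e m_closed)
  qed
  have inv: "(\<one> \<oplus> z) \<otimes> (\<one> \<oplus> z \<otimes> z) = \<one>" "(\<one> \<oplus> z \<otimes> z) \<otimes> (\<one> \<oplus> z) = \<one>"
  proof -
    \<comment> \<open>Both products expand to this sum.\<close>
    have "\<one> \<oplus> (z \<oplus> z \<otimes> z \<oplus> z \<otimes> z \<otimes> z) = \<one>"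
      using eq by simp
    then show "(\<one> \<oplus> z) \<otimes> (\<one> \<oplus> z \<otimes> z) = \<one>" "(\<one> \<oplus> z \<otimes> z) \<otimes> (\<one> \<oplus> z) = \<one>"
      using z by (simp_all add: l_distr r_distr a_ac m_assoc)
  qed
  then have "\<one> \<oplus> z \<in> Units R"
    using z unfolding Units_def by blast
  then obtain y where "y \<in> J_sharp R" "\<one> \<oplus> z = \<one> \<oplus> y"
    using UJ unfolding UJ_sharp_ring_def by blast
  then have "z \<in> J_sharp R"
    using z by (simp add: J_sharp_def)
  then obtain m :: nat where m: "m \<ge> 1" "z [^] m \<in> jacobson_radical R"
    by (auto simp: J_sharp_def)
  define I where "I = {x \<in> carrier R. x \<otimes> z = \<zero>}"
  have "left_ideal I R"
    using z by (auto intro!: left_idealI simp: I_def l_distr m_assoc)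
  moreover have "\<one> \<notin> I"
    using z by (simp add: I_def)
  ultimately obtain M where M: "maximal_left_ideal M R" "I \<subseteq> M"
    by (rule proper_left_ideal_subset_maximal)
  have lM: "left_ideal M R"
    using M(1) by (simp add: maximal_left_ideal_def)
  have "z [^] m \<in> M"
    using m(2) M(1) by (simp add: jacobson_radical_def)
  \<comment> \<open>The factor z^(2m) raises the exponent to 3m, turning the power of z into a power
    of the idempotent e.\<close>
  then have "z [^] (2 * m) \<otimes> z [^] m \<in> M"
    using left_idealD(4)[OF lM] z by simp
  also have "z [^] (2 * m) \<otimes> z [^] m = e [^] m"
  proof -
    have "e = z [^] (3::nat)"
      using z by (simp add: e_def numeral_3_eq_3)
    then show ?thesis
      using z by (simp add: nat_pow_mult nat_pow_pow)
  qed
  also have "e [^] m = e"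
    using m(1)
  proof (induction m rule: dec_induct)
    case (step k)
    have "e \<otimes> e = e"
      using ez z by (metis e e_def m_assoc m_closed)
    with step show ?case
      by simp
  qed simp
  finally have "e \<in> M" .
  \<comment> \<open>(1 - e) z = z - z^4 = 0.\<close>
  moreover have "\<one> \<ominus> e \<in> I"
    using z ez by (simp add: I_def minus_eq l_distr l_minus r_neg)
  ultimately have "(\<one> \<ominus> e) \<oplus> e \<in> M"
    using M(2) left_idealD(3)[OF lM] by blast
  then have "\<one> \<in> M"
    by (simp add: minus_eq a_assoc l_neg)
  then show False
    using M(1) left_ideal_eq_carrier_iff[OF lM] by (simp add: maximal_left_ideal_def)
qed

end

text \<open>For n \<ge> 2 this embeds the 2 x 2 matrices compatibly with sums and products, but for
  n > 2 not with the identity. Hence the relation imposed on z has no constant term.\<close>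

definition corner_mat :: "nat \<Rightarrow> 'a \<Rightarrow> 'a \<Rightarrow> 'a \<Rightarrow> 'a \<Rightarrow> 'a :: ring_1 mat" where
  "corner_mat n a b c d = mat n n (\<lambda>(i, j).
     if i = 0 \<and> j = 0 then a else if i = 0 \<and> j = 1 then b else
     if i = 1 \<and> j = 0 then c else if i = 1 \<and> j = 1 then d else 0)"

lemma corner_mat_carrier [simp]: "corner_mat n a b c d \<in> carrier_mat n n"
  by (simp add: corner_mat_def)

lemma corner_mat_add:
  "corner_mat n a b c d + corner_mat n a' b' c' d' = corner_mat n (a + a') (b + b') (c + c') (d + d')"
  by (rule eq_matI) (auto simp: corner_mat_def)

lemma corner_mat_zero: "corner_mat n 0 0 0 0 = 0\<^sub>m n n"
  by (rule eq_matI) (auto simp: corner_mat_def)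

lemma corner_mat_mult:
  assumes "n \<ge> 2"
  shows "corner_mat n a b c d * corner_mat n a' b' c' d' =
    corner_mat n (a * a' + b * c') (a * b' + b * d') (c * a' + d * c') (c * b' + d * d')"
    (is "?A * ?B = ?C")
proof (rule eq_matI)
  fix i j
  assume "i < dim_row ?C" "j < dim_col ?C"
  then have ij: "i < n" "j < n"
    by (simp_all add: corner_mat_def)
  have "(?A * ?B) $$ (i, j) = (\<Sum>k = 0..<n. ?A $$ (i, k) * ?B $$ (k, j))"
    using ij by (simp add: scalar_prod_def corner_mat_def)
  \<comment> \<open>Columns of \<open>?A\<close> beyond the first two vanish, and n \<ge> 2 puts
    both indices 0 and 1 in range.\<close>
  also have "\<dots> = (\<Sum>k\<in>{0, 1}. ?A $$ (i, k) * ?B $$ (k, j))"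
    using assms ij by (intro sum.mono_neutral_right) (auto simp: corner_mat_def)
  also have "\<dots> = ?C $$ (i, j)"
    using assms ij by (auto simp: corner_mat_def)
  finally show "(?A * ?B) $$ (i, j) = ?C $$ (i, j)" .
qed (simp_all add: corner_mat_def)

theorem lemma2p15:
  fixes n :: nat
  assumes "n \<ge> 2"
  shows "\<not> UJ_sharp_ring (ring_mat TYPE('s :: ring_1) n ())"
proof -
  interpret ring "ring_mat TYPE('s) n ()"
    by (rule ring_mat_noncomm)
  \<comment> \<open>The block has trace -1 and determinant 1, so its characteristic polynomial is
    X^2 + X + 1. Its square has rows (-1, -1) and (1, 0), and its cube is the identity
    block.\<close>
  define z :: "'s mat" where "z = corner_mat n 0 1 (- 1) (- 1)"
  have "z $$ (0, 1) \<noteq> 0\<^sub>m n n $$ (0, 1)"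
    using assms by (simp add: z_def corner_mat_def)
  then have "z \<noteq> 0\<^sub>m n n"
    by metis
  moreover have "z + z * z + z * z * z = 0\<^sub>m n n"
    using assms by (simp add: z_def corner_mat_mult corner_mat_add corner_mat_zero)
  ultimately show ?thesis
    by (intro not_UJ_sharp_ring_if_cube_root[of z]) (simp_all add: ring_mat_def z_def)
qed

end
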